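(* Let $\mathcal H$ be a real Hilbert space, let $\mathcal X_n$ ($n\ge1$) be linear subspaces of $\mathcal H$, let $\mathcal E$ be a metric space, let $\Upsilon:\mathcal H\to\mathcal E$ and $\Upsilon_n:\mathcal X_n\to\mathcal E$ be maps, and let $\Phi:\mathcal E\to\mathbb R$ be continuous. Assume: (1) Whenever $n_j\to+\infty$ and $h_j\in\mathcal X_{n_j}$ satisfy $h_j\rightharpoonup h$ weakly in $\mathcal H$, one has $\Upsilon_{n_j}(h_j)\to\Upsilon(h)$ in $\mathcal E$. (2) There are operators $Q_n:\mathcal H\to\mathcal X_n$, $n\ge1$, such that $Q_nh\to h$ in $\mathcal H$ as $n\to\infty$ for every $h\in\mathcal H$. (3) Whenever $h_n^0\in\mathcal X_n$, $h\in\mathcal H$ and $h_n^0\to h$ in $\mathcal H$, then for every $q\in\mathcal H$, with $q_n:=Q_nq$, and every $a_0>0$, the family of maps $a\mapsto\Phi(\Upsilon_n(h_n^0+aq_n))$, $n\ge1$, is equicontinuous on $[-a_0,a_0]$. (4) The map $\mathcal T:\mathcal H\to\mathbb R$, $\mathcal T(h):=\Phi(\Upsilon(h))$, is $C^1$ on $\mathcal H$, and for every $h\in\mathcal H$ there is $q_h\in\mathcal H$ with $D\mathcal T(h)[q_h]\neq0$. Let $h_n^0\in\mathcal X_n$ satisfy $h_n^0\to h$ in $\mathcal H$ for some $h\in\mathcal H$, and let $c_n\in\mathbb R$ with $c_n\to0$. Then there exist $n_0\ge1$ and $r_n\in\mathcal X_n$, $n\ge n_0$, such that $$\Phi(\Upsilon_n(h_n^0+r_n))=\Phi(\Upsilon_n(h_n^0))+c_n\quad(n\ge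 n_0),\qquad \lim_{n\to\infty}\|r_n\|_{\mathcal H}=0 .$$
   Context: $D\mathcal T(h)[q]$ denotes the (Fréchet) derivative of $\mathcal T$ at $h$ in direction $q$. *)

theory Defs
  imports "HOL-Analysis.Analysis"
begin

definition weakly_tendsto :: "(nat \<Rightarrow> 'a::real_normed_vector) \<Rightarrow> 'a \<Rightarrow> bool"
  where "weakly_tendsto x l \<longleftrightarrow>
    (\<forall>f::'a \<Rightarrow> real. bounded_linear f \<longrightarrow> (\<lambda>j. f (x j)) \<longlonglongrightarrow> f l)"

definition equicontinuous_family_on ::
    "'a::metric_space set \<Rightarrow> 'i set \<Rightarrow> ('i \<Rightarrow> 'a \<Rightarrow> 'b::metric_space) \<Rightarrow> bool"
  where "equicontinuous_family_on S I F \<longleftrightarrow>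
    (\<forall>a\<in>S. \<forall>\<epsilon>>0. \<exists>\<delta>>0. \<forall>b\<in>S. dist b a < \<delta> \<longrightarrow> (\<forall>i\<in>I. dist (F i b) (F i a) < \<epsilon>))"

(* The derivative is required to be continuous for the operator norm, which is the norm
   of the type of bounded linear functions. *)
definition continuously_Frechet_differentiable ::
    "('a::real_normed_vector \<Rightarrow> 'b::real_normed_vector) \<Rightarrow> bool"
  where "continuously_Frechet_differentiable f \<longleftrightarrow>
    (\<exists>D::'a \<Rightarrow> 'a \<Rightarrow>\<^sub>L 'b.
       (\<forall>x. (f has_derivative blinfun_apply (D x)) (at x)) \<and> continuous_on UNIV D)"

end

theory Submission
  imports Defs
begin

text \<open>
  Restrict to the line \<open>h0 n + a *\<^sub>R Q n q\<close>, where the derivative at \<open>h\<close> is positive in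
  direction \<open>q\<close>. These functions of \<open>a\<close> are continuous and converge pointwise to
  \<open>a \<mapsto> \<Phi> (\<Upsilon> (h + a *\<^sub>R q))\<close>, which is strictly below its value at \<open>0\<close> at
  some \<open>-d\<close> and strictly above it at some \<open>d\<close>, for arbitrarily small \<open>d\<close>. Hence, by the
  intermediate value theorem, the perturbed value is attained in \<open>[-d, d]\<close> for all large \<open>n\<close>.
  Choosing solutions \<open>a\<close> of almost minimal modulus gives a sequence that tends to \<open>0\<close>.
\<close>

lemma tendsto_imp_weakly_tendsto:
  assumes "x \<longlonglongrightarrow> l"
  shows "weakly_tendsto x l"
  unfolding weakly_tendsto_def using assms by (blast intro: bounded_linear.tendsto)

lemma equicontinuous_family_on_imp_continuous_on:
  assumes "equicontinuous_family_on S I F" "i \<in> I"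
  shows "continuous_on S (F i)"
  using assms unfolding equicontinuous_family_on_def continuous_on_iff by meson

text \<open>The norms are bounded below by 0, so their infimum exists. It need not be attained, as
  \<open>A\<close> is arbitrary; hence the slack \<open>e\<close>.\<close>

lemma almost_minimal_norm:
  fixes A :: "'a::real_normed_vector set"
  assumes "A \<noteq> {}" "e > 0"
  obtains a where "a \<in> A" "\<And>b. b \<in> A \<Longrightarrow> norm a < norm b + e"
proof -
  have bdd: "bdd_below (norm ` A)"
    by (rule bdd_belowI2[of _ 0]) simp
  have "Inf (norm ` A) < Inf (norm ` A) + e"
    using assms by simp
  then obtain a where a: "a \<in> A" "norm a < Inf (norm ` A) + e"
    using cInf_lessD[of "norm ` A"] assms by blast
  show thesis
  proof (rule that[OF a(1)])
    fix b assume "b \<in> A"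
    then have "Inf (norm ` A) \<le> norm b"
      using bdd by (simp add: cInf_lower)
    then show "norm a < norm b + e"
      using a(2) by simp
  qed
qed

text \<open>The threshold for \<open>n\<close> depends on \<open>e\<close>, so solutions found for
  separate \<open>e\<close> do not directly form one sequence. Taking \<open>a n\<close> with norm
  within \<open>1/(n+1)\<close> of the infimum over all solutions removes this dependence: any small
  solution bounds \<open>a n\<close> up to a vanishing error.\<close>

lemma eventually_small_solutions_imp_null_sequence:
  fixes P :: "nat \<Rightarrow> 'a::real_normed_vector \<Rightarrow> bool"
  assumes small: "\<And>e. e > 0 \<Longrightarrow> \<forall>\<^sub>F n in sequentially. \<exists>a. P n a \<and> norm a \<le> e"
  obtains a where "\<forall>\<^sub>F n in sequentially. P n (a n)" "a \<longlonglongrightarrow> 0"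
proof -
  \<comment> \<open>The premise lets the choice be made for every \<open>n\<close>; where no
    solution exists, the value is arbitrary.\<close>
  have "\<exists>a. (\<exists>b. P n b) \<longrightarrow> P n a \<and> (\<forall>b. P n b \<longrightarrow> norm a < norm b + inverse (real (Suc n)))" for n
  proof (cases "\<exists>b. P n b")
    case True
    then obtain a where "a \<in> Collect (P n)"
        "\<And>b. b \<in> Collect (P n) \<Longrightarrow> norm a < norm b + inverse (real (Suc n))"
      using almost_minimal_norm[of "Collect (P n)" "inverse (real (Suc n))"] by auto
    then show ?thesis
      by auto
  qed simp
  then obtain a where a: "\<And>n b. P n b \<Longrightarrow> P n (a n)"
      "\<And>n b. P n b \<Longrightarrow> norm (a n) < norm b + inverse (real (Suc n))"
    by metis
  have "\<forall>\<^sub>F n in sequentially. P n (a n)"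
    by (rule eventually_mono[OF small[OF zero_less_one]]) (auto intro: a)
  moreover have "a \<longlonglongrightarrow> 0"
    unfolding tendsto_iff
  proof (intro allI impI)
    fix e :: real assume "e > 0"
    then have "\<forall>\<^sub>F n in sequentially. inverse (real (Suc n)) < e / 2"
        and "\<forall>\<^sub>F n in sequentially. \<exists>b. P n b \<and> norm b \<le> e / 2"
      using order_tendstoD(2)[OF LIMSEQ_inverse_real_of_nat, of "e / 2"] small[of "e / 2"]
      by simp_all
    then show "\<forall>\<^sub>F n in sequentially. dist (a n) 0 < e"
    proof eventually_elim
      case (elim n)
      then obtain b where "P n b" "norm b \<le> e / 2"
        by blast
      then have "norm (a n) < e"
        using a(2)[of n b] elim(1) by linarith
      then show ?case
        by simp
    qed
  qed
  ultimately show thesis by (rule that)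
qed

text \<open>Pointwise limits are taken only at \<open>-d\<close>, \<open>0\<close> and
  \<open>d\<close>. The strict signs at both ends persist for large \<open>n\<close>, so the
  intermediate value theorem applies to \<open>f n\<close>.\<close>

lemma perturbed_value_attained:
  fixes f :: "nat \<Rightarrow> real \<Rightarrow> real"
  assumes cont: "\<forall>\<^sub>F n in sequentially. continuous_on {-1..1} (f n)"
    and lim: "\<And>a. (\<lambda>n. f n a) \<longlonglongrightarrow> g a"
    and deriv: "(g has_real_derivative D) (at 0)" "D > 0"
    and c: "c \<longlonglongrightarrow> 0" and e: "e > 0"
  shows "\<forall>\<^sub>F n in sequentially. \<exists>a. f n a = f n 0 + c n \<and> norm a \<le> e"
proof -
  obtain d1 where d1: "d1 > 0" "\<And>t. t > 0 \<Longrightarrow> t < d1 \<Longrightarrow> g 0 < g t"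
    using DERIV_pos_inc_right[OF deriv] by auto
  obtain d2 where d2: "d2 > 0" "\<And>t. t > 0 \<Longrightarrow> t < d2 \<Longrightarrow> g (- t) < g 0"
    using DERIV_pos_inc_left[OF deriv] by auto
  \<comment> \<open>Halving makes \<open>d < d1\<close> and \<open>d < d2\<close> strict; the bound
    by 1 keeps \<open>[-d, d]\<close> inside the interval of continuity.\<close>
  define d where "d = min (min d1 d2) (min e 1) / 2"
  have d: "d > 0" "d < d1" "d < d2" "d \<le> e" "d \<le> 1"
    using d1(1) d2(1) e by (auto simp: d_def min_def)
  have lim0: "(\<lambda>n. f n 0 + c n) \<longlonglongrightarrow> g 0"
    using tendsto_add[OF lim c] by simp
  have "\<forall>\<^sub>F n in sequentially. 0 < f n d - (f n 0 + c n)"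
    using order_tendstoD(1)[OF tendsto_diff[OF lim lim0], of 0 d] d1(2) d by simp
  moreover have "\<forall>\<^sub>F n in sequentially. f n (- d) - (f n 0 + c n) < 0"
    using order_tendstoD(2)[OF tendsto_diff[OF lim lim0], of "- d" 0] d2(2) d by simp
  ultimately show ?thesis
    using cont
  proof eventually_elim
    case (elim n)
    have "continuous_on {-d..d} (f n)"
      using elim(3) by (rule continuous_on_subset) (use d in auto)
    then obtain a where "- d \<le> a" "a \<le> d" "f n a = f n 0 + c n"
      using IVT'[of "f n" "- d" "f n 0 + c n" d] elim d(1) by auto
    then show ?case
      using d(4) by (intro exI[of _ a]) auto
  qed
qed

text \<open>By the chain rule and homogeneity of \<open>F'\<close>, the derivative in
  \<open>a\<close> is multiplication by the number \<open>F' q\<close>.\<close>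

lemma has_real_derivative_along_line:
  assumes "(F has_derivative F') (at x)"
  shows "((\<lambda>a. F (x + a *\<^sub>R q)) has_real_derivative F' q) (at 0)"
proof -
  interpret F': bounded_linear F'
    using assms by (rule has_derivative_bounded_linear)
  have line: "((\<lambda>a. x + a *\<^sub>R q) has_derivative (\<lambda>a. a *\<^sub>R q)) (at 0)"
    by (auto intro!: derivative_eq_intros)
  have "(F has_derivative F') (at (x + 0 *\<^sub>R q))"
    using assms by simp
  from has_derivative_compose[OF line this]
  have "((\<lambda>a. F (x + a *\<^sub>R q)) has_derivative (\<lambda>a. F' q * a)) (at 0)"
    by (simp add: F'.scaleR mult.commute)
  then show ?thesis
    by (simp add: has_field_derivative_def)
qed

theorem lemma2p11:
  fixes X :: "nat \<Rightarrow> 'h::{real_inner,banach} set"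
    and \<Upsilon> :: "'h \<Rightarrow> 'e::metric_space"
    and \<Upsilon>n :: "nat \<Rightarrow> 'h \<Rightarrow> 'e"
    and \<Phi> :: "'e \<Rightarrow> real"
    and Q :: "nat \<Rightarrow> 'h \<Rightarrow> 'h"
    and h0 :: "nat \<Rightarrow> 'h" and h :: 'h and c :: "nat \<Rightarrow> real"
  assumes subspaces: "\<And>n. n \<ge> 1 \<Longrightarrow> subspace (X n)"
    and cont: "continuous_on UNIV \<Phi>"
    and weak_conv: "\<And>nj hj g.
          filterlim nj at_top sequentially \<Longrightarrow> (\<And>j. nj j \<ge> 1) \<Longrightarrow> (\<And>j. hj j \<in> X (nj j)) \<Longrightarrow>
          weakly_tendsto hj g \<Longrightarrow> (\<lambda>j. \<Upsilon>n (nj j) (hj j)) \<longlonglongrightarrow> \<Upsilon> g"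
    and Q_range: "\<And>n g. n \<ge> 1 \<Longrightarrow> Q n g \<in> X n"
    and Q_approx: "\<And>g. (\<lambda>n. Q n g) \<longlonglongrightarrow> g"
    and equicont: "\<And>k0 g q a0.
          (\<And>n. n \<ge> 1 \<Longrightarrow> k0 n \<in> X n) \<Longrightarrow> k0 \<longlonglongrightarrow> g \<Longrightarrow> a0 > 0 \<Longrightarrow>
          equicontinuous_family_on {-a0..a0::real} {1..} (\<lambda>n a. \<Phi> (\<Upsilon>n n (k0 n + a *\<^sub>R Q n q)))"
    and C1: "continuously_Frechet_differentiable (\<lambda>g. \<Phi> (\<Upsilon> g))"
    and nondegenerate: "\<And>g. \<exists>q. frechet_derivative (\<lambda>g. \<Phi> (\<Upsilon> g)) (at g) q \<noteq> 0"
    and h0_mem: "\<And>n. n \<ge> 1 \<Longrightarrow> h0 n \<in> X n"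
    and h0_lim: "h0 \<longlonglongrightarrow> h"
    and c_lim: "c \<longlonglongrightarrow> 0"
  shows "\<exists>n0\<ge>1. \<exists>r::nat \<Rightarrow> 'h.
           (\<forall>n\<ge>n0. r n \<in> X n \<and> \<Phi> (\<Upsilon>n n (h0 n + r n)) = \<Phi> (\<Upsilon>n n (h0 n)) + c n) \<and>
           (\<lambda>n. norm (r n)) \<longlonglongrightarrow> 0"
proof -
  let ?T = "\<lambda>g. \<Phi> (\<Upsilon> g)"
  let ?D = "frechet_derivative ?T (at h)"
  have "?T differentiable at h"
    using C1 unfolding continuously_Frechet_differentiable_def differentiable_def by blast
  then have D: "(?T has_derivative ?D) (at h)"
    by (simp add: frechet_derivative_works)
  \<comment> \<open>By linearity, one of \<open>q\<close> and \<open>-q\<close> has a positive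
    derivative.\<close>
  obtain q where q: "?D q > 0"
  proof -
    obtain q where "?D q \<noteq> 0"
      using nondegenerate by blast
    moreover have "?D (- q) = - ?D q"
      using D by (intro linear_neg has_derivative_linear)
    ultimately show thesis
      using that[of q] that[of "- q"] by linarith
  qed
  define f where "f n a = \<Phi> (\<Upsilon>n n (h0 n + a *\<^sub>R Q n q))" for n a
  have mem: "a *\<^sub>R Q n q \<in> X n" if "n \<ge> 1" for n a
    using subspaces Q_range that by (simp add: subspace_scale)
  have lim: "(\<lambda>n. f n a) \<longlonglongrightarrow> ?T (h + a *\<^sub>R q)" for a
  proof -
    have "(\<lambda>n. h0 n + a *\<^sub>R Q n q) \<longlonglongrightarrow> h + a *\<^sub>R q"
      by (intro tendsto_intros h0_lim Q_approx)
    \<comment> \<open>The index sequence is \<open>j + 1\<close> because \<open>weak_conv\<close>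
      asks for indices \<ge> 1; the shift is undone at the end.\<close>
    then have "weakly_tendsto (\<lambda>j. h0 (Suc j) + a *\<^sub>R Q (Suc j) q) (h + a *\<^sub>R q)"
      by (intro tendsto_imp_weakly_tendsto LIMSEQ_Suc)
    moreover have "h0 (Suc j) + a *\<^sub>R Q (Suc j) q \<in> X (Suc j)" for j
      using subspaces h0_mem mem by (simp add: subspace_add)
    ultimately have "(\<lambda>j. \<Upsilon>n (Suc j) (h0 (Suc j) + a *\<^sub>R Q (Suc j) q)) \<longlonglongrightarrow> \<Upsilon> (h + a *\<^sub>R q)"
      by (intro weak_conv filterlim_Suc) auto
    then have "(\<lambda>j. f (Suc j) a) \<longlonglongrightarrow> ?T (h + a *\<^sub>R q)"
      unfolding f_def using continuous_on_tendsto_compose[OF cont] by simp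
    then show ?thesis
      by (rule LIMSEQ_imp_Suc)
  qed
  \<comment> \<open>Each member of an equicontinuous family is continuous; the radius is
    \<open>a0 = 1\<close>.\<close>
  have "continuous_on {-1..1} (f n)" if "n \<ge> 1" for n
    using equicontinuous_family_on_imp_continuous_on[OF equicont[OF h0_mem h0_lim zero_less_one]] that
    by (simp add: f_def[abs_def])
  then have cont_f: "\<forall>\<^sub>F n in sequentially. continuous_on {-1..1} (f n)"
    by (rule eventually_sequentiallyI)
  obtain a where a: "\<forall>\<^sub>F n in sequentially. f n (a n) = f n 0 + c n" "a \<longlonglongrightarrow> 0"
    using eventually_small_solutions_imp_null_sequence
      [OF perturbed_value_attained[OF cont_f lim has_real_derivative_along_line[OF D] q c_lim]]
    by blast
  from a(1) obtain N where N: "\<And>n. n \<ge> N \<Longrightarrow> f n (a n) = f n 0 + c n"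
    by (auto simp: eventually_sequentially)
  define r where "r n = a n *\<^sub>R Q n q" for n
  \<comment> \<open>Since \<open>Q n q\<close> tends to \<open>q\<close>, the product with
    \<open>a n\<close> tends to \<open>0 *\<^sub>R q = 0\<close>.\<close>
  have "(\<lambda>n. norm (r n)) \<longlonglongrightarrow> 0"
    using tendsto_norm[OF tendsto_scaleR[OF a(2) Q_approx[of q]]] by (simp add: r_def)
  \<comment> \<open>The bound \<open>N\<close> serves the equation, the bound 1 the membership in
    the subspace.\<close>
  moreover have "r n \<in> X n \<and> \<Phi> (\<Upsilon>n n (h0 n + r n)) = \<Phi> (\<Upsilon>n n (h0 n)) + c n"
    if "n \<ge> max 1 N" for n
    using N[of n] mem[of n "a n"] that by (simp add: f_def r_def)
  ultimately show ?thesis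
    by (intro exI[of _ "max 1 N"] exI[of _ r] conjI) auto
qed

end
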